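(* Let $a\in\mathbb{R}$, $b\in\mathbb{N}_{a+1}$, $m,M\in\mathbb{R}$, $\alpha>0$, and let $w:\mathbb{N}_a\to\mathbb{R}\setminus\{0\}$ satisfy $\frac{w(a)}{w(k)}>0$ for all $k\in\mathbb{N}_{a+1}$. Let $x:\mathbb{N}_{a+1}^b\to[m,M]$. Then for all $k\in\mathbb{N}_{a+1}$ with $k\le b$, $$m\;{}_a^{\rm G}\nabla_k^{-\alpha,w(k)}1\le {}_a^{\rm G}\nabla_k^{-\alpha,w(k)}x(k)\le M\;{}_a^{\rm G}\nabla_k^{-\alpha,w(k)}1.$$
   Context: For $a\in\mathbb{R}$, $\mathbb{N}_a:=\{a,a+1,a+2,\dots\}$ and $\mathbb{N}_{a+1}^b:=\{a+1,a+2,\dots,b\}$. The rising function is $p^{\overline{q}}:=\frac{\Gamma(p+q)}{\Gamma(p)}$. For $\alpha>0$ and $k\in\mathbb{N}_{a+1}$, the Grünwald–Letnikov fractional sum is ${}_a^{\rm G}\nabla_k^{-\alpha}x(k):=\sum_{j=a+1}^{k}\frac{(k-j+1)^{\overline{\alpha-1}}}{\Gamma(\alpha)}x(j)$, and the tempered sum is ${}_a^{\rm G}\nabla_k^{-\alpha,w(k)}x(k):=w^{-1}(k)\,{}_a^{\rm G}\nabla_k^{-\alpha}[w(k)x(k)]=\sum_{j=a+1}^{k}\frac{(k-j+1)^{\overline{\alpha-1}}}{\Gamma(\alpha)}\frac{w(j)}{w(k)}x(j)$. ${}_a^{\rm G}\nabla_k^{-\alpha,w(k)}1$ is the operator applied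 to the constant sequence $1$. *)

theory Defs
  imports "HOL-Analysis.Analysis"
begin

text \<open>The shifted half-line \<open>{a, a + 1, a + 2, \<dots>}\<close> for a real base point, and its
  truncation \<open>{a, a + 1, \<dots>, b}\<close> (empty when \<open>b < a\<close>). Sequences on these sets are
  represented by functions on all reals, of which only the values on the set matter.\<close>

definition nats_from :: "real \<Rightarrow> real set" where
  "nats_from a = {a + real n | n. True}"

definition nats_between :: "real \<Rightarrow> real \<Rightarrow> real set" where
  "nats_between a b = {t \<in> nats_from a. t \<le> b}"

text \<open>Since \<open>Gamma\<close> is total with value \<open>0\<close> at its poles, this is the usual rising function
  only when \<open>p\<close> and \<open>p + q\<close> are not poles; below, \<open>p \<ge> 1\<close> and \<open>p + q > 0\<close>.\<close>

definition rising :: "real \<Rightarrow> real \<Rightarrow> real" where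
  "rising p q = Gamma (p + q) / Gamma p"

definition GL_sum :: "real \<Rightarrow> real \<Rightarrow> (real \<Rightarrow> real) \<Rightarrow> real \<Rightarrow> real" where
  "GL_sum a \<alpha> x k =
     (\<Sum>j \<in> nats_between (a + 1) k. rising (k - j + 1) (\<alpha> - 1) / Gamma \<alpha> * x j)"

definition tempered_GL_sum ::
    "real \<Rightarrow> real \<Rightarrow> (real \<Rightarrow> real) \<Rightarrow> (real \<Rightarrow> real) \<Rightarrow> real \<Rightarrow> real" where
  "tempered_GL_sum a \<alpha> w x k = inverse (w k) * GL_sum a \<alpha> (\<lambda>j. w j * x j) k"

lemma finite_nats_between: "finite (nats_between a b)"
proof (rule finite_subset)
  show "nats_between a b \<subseteq> (\<lambda>n. a + real n) ` {..nat \<lfloor>b - a\<rfloor>}"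
  proof
    fix t assume "t \<in> nats_between a b"
    then obtain n where n: "t = a + real n" "a + real n \<le> b"
      unfolding nats_between_def nats_from_def by auto
    then have "n \<le> nat \<lfloor>b - a\<rfloor>"
      by (intro le_nat_floor) simp
    with n show "t \<in> (\<lambda>n. a + real n) ` {..nat \<lfloor>b - a\<rfloor>}" by auto
  qed
qed simp

lemma tempered_GL_sum_eq:
  "tempered_GL_sum a \<alpha> w x k =
     (\<Sum>j \<in> nats_between (a + 1) k. rising (k - j + 1) (\<alpha> - 1) / Gamma \<alpha> * (w j / w k) * x j)"
  unfolding tempered_GL_sum_def GL_sum_def sum_distrib_left
  by (intro sum.cong refl) (simp add: field_simps)

end

theory Submission
  imports Defs
begin

text \<open>The tempered sum at \<open>k\<close> is a finite linear combination of the values \<open>x j\<close> with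
  \<open>j \<le> k\<close>, whose coefficients are the Grunwald-Letnikov kernel times the ratio \<open>w j / w k\<close>.
  The kernel is a quotient of Gamma values at positive arguments, and the ratio is positive
  because \<open>w j\<close> and \<open>w k\<close> both have the sign of \<open>w a\<close>. So the operator is monotone
  (\<open>tempered_GL_sum_mono\<close>). Both bounds follow by comparing \<open>x\<close> with the constant sequences
  \<open>m\<close> and \<open>M\<close>, since by homogeneity (\<open>tempered_GL_sum_const\<close>) a constant factors out.\<close>

lemma rising_pos:
  assumes "p > 0" and "p + q > 0"
  shows "rising p q > 0"
  using assms by (simp add: rising_def)

lemma GL_kernel_pos:
  fixes \<alpha> j k :: real
  assumes "\<alpha> > 0" and "j \<le> k"
  shows "rising (k - j + 1) (\<alpha> - 1) / Gamma \<alpha> > 0"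
  using assms by (intro divide_pos_pos rising_pos Gamma_real_pos) auto

lemma weight_ratio_pos:
  fixes u v c :: real
  assumes "c / u > 0" and "c / v > 0"
  shows "u / v > 0"
  using assms by (auto simp: zero_less_divide_iff)

lemma tempered_GL_sum_mono:
  assumes "\<alpha> > 0"
    and "\<And>j. j \<in> nats_between (a + 1) k \<Longrightarrow> w j / w k > 0"
    and "\<And>j. j \<in> nats_between (a + 1) k \<Longrightarrow> x j \<le> y j"
  shows "tempered_GL_sum a \<alpha> w x k \<le> tempered_GL_sum a \<alpha> w y k"
  unfolding tempered_GL_sum_eq
proof (rule sum_mono)
  fix j assume j: "j \<in> nats_between (a + 1) k"
  then have "rising (k - j + 1) (\<alpha> - 1) / Gamma \<alpha> * (w j / w k) > 0"
    using assms(1,2) by (intro mult_pos_pos GL_kernel_pos) (auto simp: nats_between_def)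
  then show "rising (k - j + 1) (\<alpha> - 1) / Gamma \<alpha> * (w j / w k) * x j
      \<le> rising (k - j + 1) (\<alpha> - 1) / Gamma \<alpha> * (w j / w k) * y j"
    using assms(3)[OF j] by (intro mult_left_mono) auto
qed

lemma tempered_GL_sum_const:
  "tempered_GL_sum a \<alpha> w (\<lambda>_. c) k = c * tempered_GL_sum a \<alpha> w (\<lambda>_. 1) k"
  unfolding tempered_GL_sum_eq sum_distrib_left by (rule sum.cong) auto

theorem theorem3p15:
  fixes a b m M \<alpha> :: real and w x :: "real \<Rightarrow> real"
  assumes "b \<in> nats_from (a + 1)"
    and "\<alpha> > 0"
    and "\<forall>k \<in> nats_from a. w k \<noteq> 0"
    and "\<forall>k \<in> nats_from (a + 1). w a / w k > 0"
    and "x \<in> nats_between (a + 1) b \<rightarrow> {m..M}"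
  shows "\<forall>k \<in> nats_from (a + 1). k \<le> b \<longrightarrow>
           m * tempered_GL_sum a \<alpha> w (\<lambda>_. 1) k \<le> tempered_GL_sum a \<alpha> w x k \<and>
           tempered_GL_sum a \<alpha> w x k \<le> M * tempered_GL_sum a \<alpha> w (\<lambda>_. 1) k"
proof (intro ballI impI)
  fix k assume k: "k \<in> nats_from (a + 1)" and kb: "k \<le> b"
  have ratio: "w j / w k > 0" if "j \<in> nats_between (a + 1) k" for j
  proof (rule weight_ratio_pos)
    have "j \<in> nats_from (a + 1)" using that by (simp add: nats_between_def)
    then show "w a / w j > 0" using assms(4) by blast
    show "w a / w k > 0" using assms(4) k by blast
  qed
  have bounds: "m \<le> x j" "x j \<le> M" if "j \<in> nats_between (a + 1) k" for j
  proof -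
    have "j \<in> nats_between (a + 1) b"
      using that kb by (auto simp: nats_between_def)
    then have "x j \<in> {m..M}" using assms(5) by blast
    then show "m \<le> x j" "x j \<le> M" by auto
  qed
  have "tempered_GL_sum a \<alpha> w (\<lambda>_. m) k \<le> tempered_GL_sum a \<alpha> w x k"
    by (rule tempered_GL_sum_mono) (fact assms(2) ratio bounds(1))+
  moreover have "tempered_GL_sum a \<alpha> w x k \<le> tempered_GL_sum a \<alpha> w (\<lambda>_. M) k"
    by (rule tempered_GL_sum_mono) (fact assms(2) ratio bounds(2))+
  ultimately show "m * tempered_GL_sum a \<alpha> w (\<lambda>_. 1) k \<le> tempered_GL_sum a \<alpha> w x k \<and>
      tempered_GL_sum a \<alpha> w x k \<le> M * tempered_GL_sum a \<alpha> w (\<lambda>_. 1) k"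
    unfolding tempered_GL_sum_const[of _ _ _ m] tempered_GL_sum_const[of _ _ _ M] by (rule conjI)
qed

end
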